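(* Let $(M,\eta,\omega)$ be a closed conformal symplectic manifold and $H:M\to\mathbb{R}$ a Hamiltonian. Assume that there exists an open set $U\subset M$ containing $\{H=0\}$ such that $\eta|_U$ is exact, i.e. $[\eta|_U]=0$ in $H^1(U;\mathbb{R})$. Then the map $(t,x)\mapsto r_t(x)$ is bounded on $\mathbb{R}\times M$.
   Context: A conformal symplectic manifold $(M,\eta,\omega)$ is a smooth manifold $M$ of even dimension with a closed 1-form $\eta$ (the Lee form) and a non-degenerate 2-form $\omega$ such that $\mathrm{d}_\eta\omega=0$, where $\mathrm{d}_\eta\alpha:=\mathrm{d}\alpha-\eta\wedge\alpha$. Given a smooth $H:M\to\mathbb{R}$ (the Hamiltonian), its Hamiltonian vector field $X$ is defined by $\iota_X\omega=\mathrm{d}_\eta H=\mathrm{d}H-H\eta$, and $(\varphi_t)$ denotes its flow. The winding is $r_t(x):=\int_0^t\eta(X(\varphi_s(x)))\,\mathrm{d}s$ for $t\in\mathbb{R}$, $x\in M$. *)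

theory Defs
  imports "HOL-Analysis.Analysis"
begin

section \<open>Smooth maps between Euclidean spaces\<close>

text \<open>Iterated differentiability through directional derivatives; only meant for open \<open>S\<close>.\<close>

fun C_k_on :: "nat \<Rightarrow> 'a set \<Rightarrow> ('a::euclidean_space \<Rightarrow> 'b::real_normed_vector) \<Rightarrow> bool" where
  "C_k_on 0 S f \<longleftrightarrow> continuous_on S f"
| "C_k_on (Suc k) S f \<longleftrightarrow>
     (\<forall>x\<in>S. f differentiable at x) \<and> (\<forall>e. C_k_on k S (\<lambda>x. frechet_derivative f (at x) e))"

definition smooth_on :: "'a set \<Rightarrow> ('a::euclidean_space \<Rightarrow> 'b::real_normed_vector) \<Rightarrow> bool" where
  "smooth_on S f \<longleftrightarrow> (\<forall>k. C_k_on k S f)"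


section \<open>Smooth manifolds\<close>

text \<open>A chart is a pair of its domain and its coordinate map; the values of the coordinate map
  outside the domain are irrelevant.\<close>

type_synonym ('m, 'e) chart = "'m set \<times> ('m \<Rightarrow> 'e)"

abbreviation chart_dom :: "('m, 'e) chart \<Rightarrow> 'm set" where
  "chart_dom \<equiv> fst"

abbreviation chart_map :: "('m, 'e) chart \<Rightarrow> 'm \<Rightarrow> 'e" where
  "chart_map \<equiv> snd"

definition chart_image :: "('m, 'e) chart \<Rightarrow> 'e set" where
  "chart_image c = chart_map c ` chart_dom c"

definition chart_inv :: "('m, 'e) chart \<Rightarrow> 'e \<Rightarrow> 'm" where
  "chart_inv c = inv_into (chart_dom c) (chart_map c)"

definition transition :: "('m, 'e) chart \<Rightarrow> ('m, 'e) chart \<Rightarrow> 'e \<Rightarrow> 'e" where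
  "transition c c' = chart_map c' \<circ> chart_inv c"

locale smooth_manifold =
  fixes M :: "'m topology" and A :: "('m, 'e::euclidean_space) chart set"
  assumes Hausdorff: "Hausdorff_space M"
    and second_countable: "second_countable M"
    and charts_cover: "(\<Union>c\<in>A. chart_dom c) = topspace M"
    and chart_dom_open: "c \<in> A \<Longrightarrow> openin M (chart_dom c)"
    and chart_image_open: "c \<in> A \<Longrightarrow> open (chart_image c)"
    and chart_homeomorphic: "c \<in> A \<Longrightarrow>
      homeomorphic_map (subtopology M (chart_dom c)) (top_of_set (chart_image c)) (chart_map c)"
    and transition_smooth: "c \<in> A \<Longrightarrow> c' \<in> A \<Longrightarrow>
      smooth_on (chart_map c ` (chart_dom c \<inter> chart_dom c')) (transition c c')"

definition charts_at :: "('m, 'e) chart set \<Rightarrow> 'm \<Rightarrow> ('m, 'e) chart set" where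
  "charts_at A p = {c \<in> A. p \<in> chart_dom c}"

text \<open>An arbitrary but fixed chart around each point.  It is only used to evaluate exterior
  derivatives, and the values of these on smooth forms do not depend on the choice.\<close>

definition chart_at :: "('m, 'e) chart set \<Rightarrow> 'm \<Rightarrow> ('m, 'e) chart" where
  "chart_at A p = (SOME c. c \<in> charts_at A p)"

definition smooth_fun_on ::
    "('m, 'e::euclidean_space) chart set \<Rightarrow> 'm set \<Rightarrow> ('m \<Rightarrow> real) \<Rightarrow> bool" where
  "smooth_fun_on A U f \<longleftrightarrow>
     (\<forall>c\<in>A. smooth_on (chart_map c ` (chart_dom c \<inter> U)) (f \<circ> chart_inv c))"


section \<open>Tangent vectors and vector fields\<close>

text \<open>A tangent vector at \<open>p\<close> is the family of its coordinate vectors in all charts around \<open>p\<close>,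
  related by the differentials of the transition maps.  Setting the family to \<open>0\<close> at all other
  charts makes equality of tangent vectors equality of functions.\<close>

type_synonym ('m, 'e) tangent = "('m, 'e) chart \<Rightarrow> 'e"

definition tangent_space ::
    "('m, 'e::euclidean_space) chart set \<Rightarrow> 'm \<Rightarrow> ('m, 'e) tangent set" where
  "tangent_space A p = {v.
     (\<forall>c\<in>charts_at A p. \<forall>c'\<in>charts_at A p.
        v c' = frechet_derivative (transition c c') (at (chart_map c p)) (v c)) \<and>
     (\<forall>c. c \<notin> charts_at A p \<longrightarrow> v c = 0)}"

definition tangent_zero :: "('m, 'e::euclidean_space) tangent" where
  "tangent_zero = (\<lambda>c. 0)"

definition tangent_lincomb :: "real \<Rightarrow> ('m, 'e::euclidean_space) tangent \<Rightarrow>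
    real \<Rightarrow> ('m, 'e) tangent \<Rightarrow> ('m, 'e) tangent" where
  "tangent_lincomb a u b v = (\<lambda>c. a *\<^sub>R u c + b *\<^sub>R v c)"

text \<open>The tangent vector at \<open>p\<close> whose coordinate vector in the chart \<open>c\<close> is \<open>e\<close>; for fixed \<open>e\<close> this
  is the constant-coefficient coordinate vector field of \<open>c\<close>.\<close>

definition coord_vector ::
    "('m, 'e::euclidean_space) chart set \<Rightarrow> ('m, 'e) chart \<Rightarrow> 'e \<Rightarrow> 'm \<Rightarrow> ('m, 'e) tangent" where
  "coord_vector A c e p = (\<lambda>c'. if c' \<in> charts_at A p
     then frechet_derivative (transition c c') (at (chart_map c p)) e else 0)"

type_synonym ('m, 'e) vector_field = "'m \<Rightarrow> ('m, 'e) tangent"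

definition smooth_vector_field ::
    "'m topology \<Rightarrow> ('m, 'e::euclidean_space) chart set \<Rightarrow> ('m, 'e) vector_field \<Rightarrow> bool" where
  "smooth_vector_field M A X \<longleftrightarrow>
     (\<forall>p\<in>topspace M. X p \<in> tangent_space A p) \<and>
     (\<forall>c\<in>A. smooth_on (chart_image c) (\<lambda>y. X (chart_inv c y) c))"


section \<open>Differential forms\<close>

type_synonym ('m, 'e) form1 = "'m \<Rightarrow> ('m, 'e) tangent \<Rightarrow> real"
type_synonym ('m, 'e) form2 = "'m \<Rightarrow> ('m, 'e) tangent \<Rightarrow> ('m, 'e) tangent \<Rightarrow> real"

definition linear_on_tangent ::
    "('m, 'e::euclidean_space) chart set \<Rightarrow> 'm \<Rightarrow> (('m, 'e) tangent \<Rightarrow> real) \<Rightarrow> bool" where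
  "linear_on_tangent A p l \<longleftrightarrow>
     (\<forall>u\<in>tangent_space A p. \<forall>v\<in>tangent_space A p. \<forall>a b.
        l (tangent_lincomb a u b v) = a * l u + b * l v)"

definition smooth_form1 ::
    "'m topology \<Rightarrow> ('m, 'e::euclidean_space) chart set \<Rightarrow> ('m, 'e) form1 \<Rightarrow> bool" where
  "smooth_form1 M A \<alpha> \<longleftrightarrow>
     (\<forall>p\<in>topspace M. linear_on_tangent A p (\<alpha> p)) \<and>
     (\<forall>c\<in>A. \<forall>e. smooth_on (chart_image c)
        (\<lambda>y. \<alpha> (chart_inv c y) (coord_vector A c e (chart_inv c y))))"

definition smooth_form2 ::
    "'m topology \<Rightarrow> ('m, 'e::euclidean_space) chart set \<Rightarrow> ('m, 'e) form2 \<Rightarrow> bool" where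
  "smooth_form2 M A \<beta> \<longleftrightarrow>
     (\<forall>p\<in>topspace M.
        (\<forall>u\<in>tangent_space A p. linear_on_tangent A p (\<beta> p u)) \<and>
        (\<forall>v\<in>tangent_space A p. linear_on_tangent A p (\<lambda>u. \<beta> p u v)) \<and>
        (\<forall>u\<in>tangent_space A p. \<beta> p u u = 0)) \<and>
     (\<forall>c\<in>A. \<forall>e e'. smooth_on (chart_image c)
        (\<lambda>y. \<beta> (chart_inv c y) (coord_vector A c e (chart_inv c y))
                              (coord_vector A c e' (chart_inv c y))))"

definition nondegenerate ::
    "'m topology \<Rightarrow> ('m, 'e::euclidean_space) chart set \<Rightarrow> ('m, 'e) form2 \<Rightarrow> bool" where
  "nondegenerate M A \<beta> \<longleftrightarrow> (\<forall>p\<in>topspace M. \<forall>u\<in>tangent_space A p.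
     (\<forall>v\<in>tangent_space A p. \<beta> p u v = 0) \<longrightarrow> u = tangent_zero)"

text \<open>The derivative at \<open>p\<close>, along the tangent vector \<open>u\<close>, of a function defined near \<open>p\<close>.\<close>

definition deriv_along :: "('m, 'e::euclidean_space) chart set \<Rightarrow> ('m \<Rightarrow> real) \<Rightarrow>
    'm \<Rightarrow> ('m, 'e) tangent \<Rightarrow> real" where
  "deriv_along A f p u =
     (let c = chart_at A p in frechet_derivative (f \<circ> chart_inv c) (at (chart_map c p)) (u c))"

abbreviation ext_deriv0 ::
    "('m, 'e::euclidean_space) chart set \<Rightarrow> ('m \<Rightarrow> real) \<Rightarrow> ('m, 'e) form1" where
  "ext_deriv0 \<equiv> deriv_along"

text \<open>The exterior derivatives of 1- and 2-forms: the tangent vectors at \<open>p\<close> are extended to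
  constant-coefficient vector fields in a chart, so the bracket terms of the invariant formula
  vanish.\<close>

definition ext_deriv1 :: "('m, 'e::euclidean_space) chart set \<Rightarrow> ('m, 'e) form1 \<Rightarrow> ('m, 'e) form2" where
  "ext_deriv1 A \<alpha> p u v =
     (let c = chart_at A p; E = (\<lambda>w q. coord_vector A c (w c) q) in
        deriv_along A (\<lambda>q. \<alpha> q (E v q)) p u
      - deriv_along A (\<lambda>q. \<alpha> q (E u q)) p v)"

definition ext_deriv2 :: "('m, 'e::euclidean_space) chart set \<Rightarrow> ('m, 'e) form2 \<Rightarrow>
    'm \<Rightarrow> ('m, 'e) tangent \<Rightarrow> ('m, 'e) tangent \<Rightarrow> ('m, 'e) tangent \<Rightarrow> real" where
  "ext_deriv2 A \<beta> p u v w =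
     (let c = chart_at A p; E = (\<lambda>z q. coord_vector A c (z c) q) in
        deriv_along A (\<lambda>q. \<beta> q (E v q) (E w q)) p u
      - deriv_along A (\<lambda>q. \<beta> q (E u q) (E w q)) p v
      + deriv_along A (\<lambda>q. \<beta> q (E u q) (E v q)) p w)"

definition wedge12 :: "('m, 'e) form1 \<Rightarrow> ('m, 'e) form2 \<Rightarrow>
    'm \<Rightarrow> ('m, 'e) tangent \<Rightarrow> ('m, 'e) tangent \<Rightarrow> ('m, 'e) tangent \<Rightarrow> real" where
  "wedge12 \<alpha> \<beta> p u v w = \<alpha> p u * \<beta> p v w - \<alpha> p v * \<beta> p u w + \<alpha> p w * \<beta> p u v"

definition closed_form1 ::
    "'m topology \<Rightarrow> ('m, 'e::euclidean_space) chart set \<Rightarrow> ('m, 'e) form1 \<Rightarrow> bool" where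
  "closed_form1 M A \<alpha> \<longleftrightarrow> (\<forall>p\<in>topspace M. \<forall>u\<in>tangent_space A p. \<forall>v\<in>tangent_space A p.
     ext_deriv1 A \<alpha> p u v = 0)"

definition exact_on ::
    "('m, 'e::euclidean_space) chart set \<Rightarrow> 'm set \<Rightarrow> ('m, 'e) form1 \<Rightarrow> bool" where
  "exact_on A U \<alpha> \<longleftrightarrow> (\<exists>f. smooth_fun_on A U f \<and>
     (\<forall>p\<in>U. \<forall>u\<in>tangent_space A p. \<alpha> p u = ext_deriv0 A f p u))"


section \<open>Conformal symplectic manifolds\<close>

text \<open>The twisted differential \<open>d\<^sub>\<eta> \<alpha> = d\<alpha> - \<eta> \<and> \<alpha>\<close> on functions and on 2-forms.\<close>

definition lee_deriv0 :: "('m, 'e::euclidean_space) chart set \<Rightarrow> ('m, 'e) form1 \<Rightarrow>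
    ('m \<Rightarrow> real) \<Rightarrow> ('m, 'e) form1" where
  "lee_deriv0 A \<eta> f p u = ext_deriv0 A f p u - f p * \<eta> p u"

definition lee_deriv2 :: "('m, 'e::euclidean_space) chart set \<Rightarrow> ('m, 'e) form1 \<Rightarrow> ('m, 'e) form2 \<Rightarrow>
    'm \<Rightarrow> ('m, 'e) tangent \<Rightarrow> ('m, 'e) tangent \<Rightarrow> ('m, 'e) tangent \<Rightarrow> real" where
  "lee_deriv2 A \<eta> \<beta> p u v w = ext_deriv2 A \<beta> p u v w - wedge12 \<eta> \<beta> p u v w"

locale conformal_symplectic_manifold = smooth_manifold M A
  for M :: "'m topology" and A :: "('m, 'e::euclidean_space) chart set" +
  fixes \<eta> :: "('m, 'e) form1" and \<omega> :: "('m, 'e) form2"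
  assumes even_dimension: "even DIM('e)"
    and lee_form_smooth: "smooth_form1 M A \<eta>"
    and lee_form_closed: "closed_form1 M A \<eta>"
    and form_smooth: "smooth_form2 M A \<omega>"
    and form_nondegenerate: "nondegenerate M A \<omega>"
    and form_lee_closed: "\<And>p u v w. p \<in> topspace M \<Longrightarrow> u \<in> tangent_space A p \<Longrightarrow>
      v \<in> tangent_space A p \<Longrightarrow> w \<in> tangent_space A p \<Longrightarrow> lee_deriv2 A \<eta> \<omega> p u v w = 0"

text \<open>Nondegeneracy makes the Hamiltonian vector field unique on \<open>topspace M\<close>.\<close>

definition hamiltonian_vector_field :: "'m topology \<Rightarrow> ('m, 'e::euclidean_space) chart set \<Rightarrow>
    ('m, 'e) form1 \<Rightarrow> ('m, 'e) form2 \<Rightarrow> ('m \<Rightarrow> real) \<Rightarrow> ('m, 'e) vector_field \<Rightarrow> bool" where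
  "hamiltonian_vector_field M A \<eta> \<omega> H X \<longleftrightarrow>
     smooth_vector_field M A X \<and>
     (\<forall>p\<in>topspace M. \<forall>u\<in>tangent_space A p. \<omega> p (X p) u = lee_deriv0 A \<eta> H p u)"

definition integral_curve :: "'m topology \<Rightarrow> ('m, 'e::euclidean_space) chart set \<Rightarrow>
    ('m, 'e) vector_field \<Rightarrow> (real \<Rightarrow> 'm) \<Rightarrow> bool" where
  "integral_curve M A X \<gamma> \<longleftrightarrow>
     continuous_map euclideanreal M \<gamma> \<and>
     (\<forall>t. \<forall>c\<in>charts_at A (\<gamma> t).
        ((\<lambda>s. chart_map c (\<gamma> s)) has_vector_derivative X (\<gamma> t) c) (at t))"

text \<open>On a compact manifold every smooth vector field has exactly one such global flow.\<close>

definition is_flow :: "'m topology \<Rightarrow> ('m, 'e::euclidean_space) chart set \<Rightarrow>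
    ('m, 'e) vector_field \<Rightarrow> (real \<Rightarrow> 'm \<Rightarrow> 'm) \<Rightarrow> bool" where
  "is_flow M A X \<phi> \<longleftrightarrow>
     (\<forall>x\<in>topspace M. \<phi> 0 x = x \<and> integral_curve M A X (\<lambda>t. \<phi> t x))"

text \<open>The interval integral is oriented, as needed for negative \<open>t\<close>.\<close>

definition winding :: "('m, 'e) form1 \<Rightarrow> ('m, 'e) vector_field \<Rightarrow> (real \<Rightarrow> 'm \<Rightarrow> 'm) \<Rightarrow>
    real \<Rightarrow> 'm \<Rightarrow> real" where
  "winding \<eta> X \<phi> t x = (LBINT s = ereal 0..ereal t. \<eta> (\<phi> s x) (X (\<phi> s x)))"

end

theory Submission
  imports Defs
begin

text \<open>Let \<open>x\<close> be a point and write \<open>h t = H (\<phi> t x)\<close> and \<open>r t\<close> for its winding.  Since \<open>\<omega>\<close> is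
  alternating, \<open>0 = \<omega>(X, X) = dH(X) - H \<eta>(X)\<close>, so \<open>h' = h r'\<close> and therefore
  \<open>h t = h s * exp (r t - r s)\<close> (\<open>hamiltonian_along_flow\<close>).  This controls the winding between two times
  at which \<open>H\<close> is not small: if \<open>\<epsilon> \<le> \<bar>H\<bar> \<le> B\<close> at both, then \<open>\<bar>r t - r s\<bar> \<le> ln (B / \<epsilon>)\<close>.

  Where \<open>H\<close> is small, the exactness of \<open>\<eta>\<close> takes over.  By compactness there is \<open>\<epsilon> > 0\<close> such that
  \<open>K = {\<bar>H\<bar> \<le> \<epsilon>}\<close> lies in \<open>U\<close>.  As long as the orbit stays in \<open>K\<close>, the winding changes exactly as
  the primitive \<open>f\<close> of \<open>\<eta>\<close> does along the orbit, and \<open>f\<close> is bounded on the compact set \<open>K\<close>, by \<open>C\<close> say.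

  An orbit may enter and leave \<open>K\<close> infinitely often, but only three pieces of it matter
  (\<open>bound_by_excursions\<close>).  Between times \<open>s \<le> t\<close> take the first and the last time at which
  \<open>\<bar>H\<bar> \<ge> \<epsilon>\<close>.  Before the first and after the last the orbit is in \<open>K\<close>; between the two, no matter
  what the orbit does, the logarithmic estimate applies.  The total is at most
  \<open>4 * C + ln (B / \<epsilon>)\<close>, which depends on neither \<open>t\<close> nor \<open>x\<close>.

  The remaining work is to differentiate along orbits in charts: functions by the chain rule
  (\<open>has_derivative_along_integral_curve\<close>), and the winding by the fundamental theorem of calculus, for
  which \<open>\<eta>(X)\<close> has to be continuous along orbits (\<open>winding_has_real_derivative\<close>).\<close>

section \<open>Smooth functions along integral curves\<close>

lemma smooth_on_differentiable: "smooth_on S f \<Longrightarrow> x \<in> S \<Longrightarrow> f differentiable at x"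
  unfolding smooth_on_def by (metis C_k_on.simps(2))

lemma smooth_on_continuous: "smooth_on S f \<Longrightarrow> continuous_on S f"
  unfolding smooth_on_def by (metis C_k_on.simps(1))

lemma continuous_map_eventually_in_open:
  fixes \<gamma> :: "'a::topological_space \<Rightarrow> 'm"
  assumes "continuous_map euclidean M \<gamma>" "openin M V" "\<gamma> t \<in> V"
  shows "\<forall>\<^sub>F s in nhds t. \<gamma> s \<in> V"
proof -
  have "open {s. \<gamma> s \<in> V}"
    using openin_continuous_map_preimage[OF assms(1,2)] by simp
  then show ?thesis
    using assms(3) eventually_nhds_in_open[of "{s. \<gamma> s \<in> V}" t] by simp
qed

context smooth_manifold
begin

lemma chart_dom_subset: "c \<in> A \<Longrightarrow> chart_dom c \<subseteq> topspace M"
  using chart_dom_open openin_subset by blast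

lemma topspace_chart_dom: "c \<in> A \<Longrightarrow> topspace (subtopology M (chart_dom c)) = chart_dom c"
  using chart_dom_subset by (simp add: topspace_subtopology Int_absorb1)

lemma chart_inv_chart_map:
  assumes "c \<in> A" "p \<in> chart_dom c"
  shows "chart_inv c (chart_map c p) = p"
proof -
  have "inj_on (chart_map c) (chart_dom c)"
    using homeomorphic_imp_injective_map[OF chart_homeomorphic[OF assms(1)]] assms(1)
    by (metis topspace_chart_dom)
  then show ?thesis
    unfolding chart_inv_def using assms(2) by simp
qed

lemma open_chart_map_image:
  assumes "c \<in> A" "openin M V"
  shows "open (chart_map c ` (chart_dom c \<inter> V))"
proof -
  have "openin (subtopology M (chart_dom c)) (chart_dom c \<inter> V)"
    using assms(2) by (simp add: openin_subtopology_Int2)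
  then have "openin (top_of_set (chart_image c)) (chart_map c ` (chart_dom c \<inter> V))"
    using homeomorphic_imp_open_map[OF chart_homeomorphic[OF assms(1)]] open_map_def by blast
  then show ?thesis
    using chart_image_open[OF assms(1)] openin_open_trans by blast
qed

lemma charts_at_nonempty: "p \<in> topspace M \<Longrightarrow> \<exists>c. c \<in> charts_at A p"
  using charts_cover unfolding charts_at_def by blast

lemma chart_at_charts_at: "p \<in> topspace M \<Longrightarrow> chart_at A p \<in> charts_at A p"
  unfolding chart_at_def using charts_at_nonempty someI_ex by metis

text \<open>Continuity is local, and on each chart \<open>f\<close> is its coordinate expression after the chart map.\<close>

lemma smooth_fun_on_continuous_map:
  assumes f: "smooth_fun_on A U f" and U: "openin M U"
  shows "continuous_map (subtopology M U) euclideanreal f"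
proof (rule pasting_lemma[where I = A and T = "\<lambda>c. chart_dom c \<inter> U" and f = "\<lambda>c. f"])
  fix c assume c: "c \<in> A"
  show "openin (subtopology M U) (chart_dom c \<inter> U)"
    using chart_dom_open[OF c] by (simp add: openin_subtopology_Int)
  have "continuous_map (subtopology M (chart_dom c)) (top_of_set (chart_image c)) (chart_map c)"
    using chart_homeomorphic[OF c] homeomorphic_imp_continuous_map by blast
  then have "continuous_map (subtopology M (chart_dom c \<inter> U)) euclidean (chart_map c)"
    by (metis continuous_map_from_subtopology continuous_map_into_fulltopology
        subtopology_subtopology)
  moreover have "chart_map c ` topspace (subtopology M (chart_dom c \<inter> U))
      \<subseteq> chart_map c ` (chart_dom c \<inter> U)"
    by auto
  ultimately have "continuous_map (subtopology M (chart_dom c \<inter> U))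
      (top_of_set (chart_map c ` (chart_dom c \<inter> U))) (chart_map c)"
    by (simp add: continuous_map_in_subtopology image_subset_iff_funcset)
  moreover have "continuous_map (top_of_set (chart_map c ` (chart_dom c \<inter> U))) euclideanreal
      (f \<circ> chart_inv c)"
    using f c smooth_on_continuous unfolding smooth_fun_on_def continuous_map_iff_continuous
    by blast
  ultimately have "continuous_map (subtopology M (chart_dom c \<inter> U)) euclideanreal
      (f \<circ> chart_inv c \<circ> chart_map c)"
    using continuous_map_compose by blast
  then have "continuous_map (subtopology M (chart_dom c \<inter> U)) euclideanreal f"
    by (rule continuous_map_eq) (use chart_inv_chart_map[OF c] in auto)
  moreover have "U \<inter> (chart_dom c \<inter> U) = chart_dom c \<inter> U" by blast
  ultimately show "continuous_map (subtopology (subtopology M U) (chart_dom c \<inter> U)) euclideanreal f"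
    by (simp add: subtopology_subtopology)
next
  fix x assume "x \<in> topspace (subtopology M U)"
  then show "\<exists>j. j \<in> A \<and> x \<in> chart_dom j \<inter> U \<and> f x = f x"
    using charts_cover by (metis IntI UN_E Int_iff topspace_subtopology)
qed auto

text \<open>The chain rule in the chart that defines \<open>deriv_along\<close> at \<open>\<gamma> t\<close>.  The curve remains in
  the domain of this one chart for times near \<open>t\<close>.\<close>

lemma has_derivative_along_integral_curve:
  assumes f: "smooth_fun_on A U f" and U: "openin M U"
    and \<gamma>: "integral_curve M A X \<gamma>" and t: "\<gamma> t \<in> U"
  shows "((\<lambda>s. f (\<gamma> s)) has_real_derivative deriv_along A f (\<gamma> t) (X (\<gamma> t))) (at t)"
proof -
  define c where "c = chart_at A (\<gamma> t)"
  have "c \<in> charts_at A (\<gamma> t)"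
    unfolding c_def using U t openin_subset chart_at_charts_at by blast
  then have c: "c \<in> A" "\<gamma> t \<in> chart_dom c"
    unfolding charts_at_def by auto
  have D: "((\<lambda>s. chart_map c (\<gamma> s)) has_vector_derivative X (\<gamma> t) c) (at t)"
    using \<gamma> \<open>c \<in> charts_at A (\<gamma> t)\<close> unfolding integral_curve_def by blast
  have "(f \<circ> chart_inv c) differentiable at (chart_map c (\<gamma> t))"
    using f c t unfolding smooth_fun_on_def by (blast intro: smooth_on_differentiable)
  then have "((f \<circ> chart_inv c) has_derivative
      frechet_derivative (f \<circ> chart_inv c) (at (chart_map c (\<gamma> t)))) (at (chart_map c (\<gamma> t)))"
    using frechet_derivative_works by blast
  note F = this
  have deriv: "((\<lambda>s. (f \<circ> chart_inv c) (chart_map c (\<gamma> s))) has_real_derivative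
      frechet_derivative (f \<circ> chart_inv c) (at (chart_map c (\<gamma> t))) (X (\<gamma> t) c)) (at t)"
    using diff_chain_at[OF D[unfolded has_vector_derivative_def] F]
      linear_scale[OF has_derivative_linear[OF F]]
    by (simp add: has_field_derivative_def o_def mult.commute[of _ "frechet_derivative _ _ _"])
  have ev: "\<forall>\<^sub>F s in nhds t. (f \<circ> chart_inv c) (chart_map c (\<gamma> s)) = f (\<gamma> s)"
  proof -
    have "\<forall>\<^sub>F s in nhds t. \<gamma> s \<in> chart_dom c"
      using continuous_map_eventually_in_open chart_dom_open c \<gamma> unfolding integral_curve_def by blast
    then show ?thesis
      by eventually_elim (use chart_inv_chart_map[OF c(1)] in simp)
  qed
  show ?thesis
    unfolding deriv_along_def Let_def c_def[symmetric]
    by (rule DERIV_cong_ev[OF refl ev refl, THEN iffD1, OF deriv])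
qed

section \<open>Contraction of a one-form with a vector field\<close>

lemma transition_has_derivative:
  assumes "c \<in> charts_at A p" "c' \<in> charts_at A p"
  shows "(transition c c' has_derivative frechet_derivative (transition c c') (at (chart_map c p)))
    (at (chart_map c p))"
proof -
  have "transition c c' differentiable at (chart_map c p)"
    using assms by (intro smooth_on_differentiable[OF transition_smooth]) (auto simp: charts_at_def)
  then show ?thesis
    using frechet_derivative_works by blast
qed

text \<open>The chain rule for \<open>transition c c'' = transition c' c'' \<circ> transition c c'\<close>, which holds near the
  image of \<open>p\<close>.  It makes the coordinate vectors of a chart genuine tangent vectors.\<close>

lemma transition_cocycle:
  assumes "c \<in> charts_at A p" "c' \<in> charts_at A p" "c'' \<in> charts_at A p"
  shows "frechet_derivative (transition c c'') (at (chart_map c p)) e =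
    frechet_derivative (transition c' c'') (at (chart_map c' p))
      (frechet_derivative (transition c c') (at (chart_map c p)) e)"
proof -
  have c: "c \<in> A" "p \<in> chart_dom c" "c' \<in> A" "p \<in> chart_dom c'"
    using assms unfolding charts_at_def by auto
  have map_p: "transition c c' (chart_map c p) = chart_map c' p"
    unfolding transition_def using chart_inv_chart_map c by simp
  have "((transition c' c'' \<circ> transition c c') has_derivative
     frechet_derivative (transition c' c'') (at (chart_map c' p)) \<circ>
     frechet_derivative (transition c c') (at (chart_map c p))) (at (chart_map c p))"
    using diff_chain_at[OF transition_has_derivative[OF assms(1,2)]]
      transition_has_derivative[OF assms(2,3)] map_p by simp
  moreover have "open (chart_map c ` (chart_dom c \<inter> chart_dom c'))"
    using open_chart_map_image c chart_dom_open by blast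
  moreover have "chart_map c p \<in> chart_map c ` (chart_dom c \<inter> chart_dom c')"
    using c by blast
  moreover have "(transition c' c'' \<circ> transition c c') y = transition c c'' y"
    if "y \<in> chart_map c ` (chart_dom c \<inter> chart_dom c')" for y
    using that chart_inv_chart_map[OF c(1)] chart_inv_chart_map[OF c(3)] unfolding transition_def by auto
  ultimately have "(transition c c'' has_derivative
     frechet_derivative (transition c' c'') (at (chart_map c' p)) \<circ>
     frechet_derivative (transition c c') (at (chart_map c p))) (at (chart_map c p))"
    using has_derivative_transform_within_open[of "transition c' c'' \<circ> transition c c'" _
        "chart_map c p" UNIV "chart_map c ` (chart_dom c \<inter> chart_dom c')" "transition c c''"]
    by blast
  from frechet_derivative_at[OF this] show ?thesis
    by (metis comp_apply)
qed

lemma coord_vector_in_tangent_space: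
  assumes "c \<in> charts_at A p"
  shows "coord_vector A c e p \<in> tangent_space A p"
  unfolding tangent_space_def mem_Collect_eq
proof (intro conjI ballI allI impI)
  fix c' c'' assume "c' \<in> charts_at A p" "c'' \<in> charts_at A p"
  then show "coord_vector A c e p c'' =
      frechet_derivative (transition c' c'') (at (chart_map c' p)) (coord_vector A c e p c')"
    unfolding coord_vector_def using transition_cocycle[OF assms, of c' c'' e] by (simp only: if_True)
next
  fix c' assume "c' \<notin> charts_at A p"
  then show "coord_vector A c e p c' = 0"
    unfolding coord_vector_def by (simp only: if_False)
qed

lemma coord_vector_of_tangent:
  assumes "c \<in> charts_at A p" "u \<in> tangent_space A p"
  shows "coord_vector A c (u c) p = u"
proof
  fix c'
  show "coord_vector A c (u c) p c' = u c'"
    using assms unfolding tangent_space_def coord_vector_def mem_Collect_eq by (metis (no_types))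
qed

lemma coord_vector_lincomb:
  assumes "c \<in> charts_at A p"
  shows "coord_vector A c (a *\<^sub>R v + b *\<^sub>R w) p =
    tangent_lincomb a (coord_vector A c v p) b (coord_vector A c w p)"
proof
  fix c'
  show "coord_vector A c (a *\<^sub>R v + b *\<^sub>R w) p c' =
    tangent_lincomb a (coord_vector A c v p) b (coord_vector A c w p) c'"
  proof (cases "c' \<in> charts_at A p")
    case True
    have lin: "linear (frechet_derivative (transition c c') (at (chart_map c p)))"
      using transition_has_derivative[OF assms True] has_derivative_linear by blast
    show ?thesis
      using True unfolding coord_vector_def tangent_lincomb_def
      by (simp add: linear_add[OF lin] linear_scale[OF lin])
  qed (simp add: coord_vector_def tangent_lincomb_def)
qed

text \<open>Smoothness of a form is a condition on its values on the coordinate vector fields of a chart,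
  so this expansion turns the contraction of a smooth form with a smooth vector field into a finite
  sum of products of smooth coordinate functions.\<close>

lemma form1_coordinates:
  assumes l: "linear_on_tangent A p l" and c: "c \<in> charts_at A p" and u: "u \<in> tangent_space A p"
  shows "l u = (\<Sum>b\<in>Basis. (u c \<bullet> b) * l (coord_vector A c b p))"
proof -
  have lin: "l (coord_vector A c (a *\<^sub>R v + b *\<^sub>R w) p) =
      a * l (coord_vector A c v p) + b * l (coord_vector A c w p)" for a b v w
    using l coord_vector_in_tangent_space[OF c] coord_vector_lincomb[OF c]
    unfolding linear_on_tangent_def by metis
  have linear: "linear (\<lambda>e. l (coord_vector A c e p))"
    using lin[of 1 _ 1] lin[of _ _ 0] by (intro linearI) auto
  have "l (coord_vector A c (\<Sum>b\<in>Basis. (u c \<bullet> b) *\<^sub>R b) p) =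
      (\<Sum>b\<in>Basis. (u c \<bullet> b) * l (coord_vector A c b p))"
    using linear_sum[OF linear, of "\<lambda>b. (u c \<bullet> b) *\<^sub>R b" Basis] linear_scale[OF linear] by simp
  then show ?thesis
    using coord_vector_of_tangent[OF c u] by (simp add: euclidean_representation)
qed

text \<open>Near \<open>t\<close> the function factors through the coordinate expression of \<open>\<alpha>(X)\<close> in one chart
  around \<open>\<gamma> t\<close>.\<close>

lemma isCont_form1_along_integral_curve:
  assumes \<alpha>: "smooth_form1 M A \<alpha>" and X: "smooth_vector_field M A X"
    and \<gamma>: "integral_curve M A X \<gamma>"
  shows "isCont (\<lambda>s. \<alpha> (\<gamma> s) (X (\<gamma> s))) t"
proof -
  have cont: "continuous_map euclideanreal M \<gamma>"
    using \<gamma> unfolding integral_curve_def by blast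
  then have top: "\<gamma> s \<in> topspace M" for s
    by (simp add: continuous_map_def Pi_iff)
  obtain c where c: "c \<in> charts_at A (\<gamma> t)"
    using charts_at_nonempty[OF top] by blast
  then have cA: "c \<in> A" "\<gamma> t \<in> chart_dom c"
    unfolding charts_at_def by auto
  define F where "F = (\<lambda>y. \<Sum>b\<in>Basis. (X (chart_inv c y) c \<bullet> b) *
    \<alpha> (chart_inv c y) (coord_vector A c b (chart_inv c y)))"
  have "continuous_on (chart_image c) F"
    unfolding F_def using \<alpha> X cA(1) unfolding smooth_form1_def smooth_vector_field_def
    by (intro continuous_intros smooth_on_continuous) auto
  then have "isCont F (chart_map c (\<gamma> t))"
    using chart_image_open[OF cA(1)] cA(2) continuous_on_eq_continuous_at
    unfolding chart_image_def by blast
  moreover have "isCont (\<lambda>s. chart_map c (\<gamma> s)) t"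
    using \<gamma> c has_vector_derivative_continuous unfolding integral_curve_def by blast
  ultimately have "isCont (\<lambda>s. F (chart_map c (\<gamma> s))) t"
    by (rule isCont_o2[rotated])
  moreover have "\<forall>\<^sub>F s in nhds t. F (chart_map c (\<gamma> s)) = \<alpha> (\<gamma> s) (X (\<gamma> s))"
  proof -
    have "\<forall>\<^sub>F s in nhds t. \<gamma> s \<in> chart_dom c"
      using continuous_map_eventually_in_open[OF cont chart_dom_open] cA by blast
    then show ?thesis
    proof eventually_elim
      case (elim s)
      then have "c \<in> charts_at A (\<gamma> s)"
        using cA unfolding charts_at_def by blast
      moreover have "linear_on_tangent A (\<gamma> s) (\<alpha> (\<gamma> s))" "X (\<gamma> s) \<in> tangent_space A (\<gamma> s)"
        using \<alpha> X top unfolding smooth_form1_def smooth_vector_field_def by auto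
      ultimately show ?case
        using form1_coordinates chart_inv_chart_map[OF cA(1) elim] unfolding F_def by metis
    qed
  qed
  ultimately show ?thesis
    using isCont_cong[of "\<lambda>s. F (chart_map c (\<gamma> s))" "\<lambda>s. \<alpha> (\<gamma> s) (X (\<gamma> s))" t] by blast
qed

lemma winding_has_real_derivative:
  assumes "smooth_form1 M A \<alpha>" "smooth_vector_field M A X" "integral_curve M A X (\<lambda>t. \<phi> t x)"
  shows "((\<lambda>t. winding \<alpha> X \<phi> t x) has_real_derivative \<alpha> (\<phi> t x) (X (\<phi> t x))) (at t)"
proof -
  define k where "k = (\<lambda>s. \<alpha> (\<phi> s x) (X (\<phi> s x)))"
  \<comment> \<open>The fundamental theorem needs a compact interval with \<open>0\<close> inside and \<open>t\<close> in its interior.\<close>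
  define R where "R = \<bar>t\<bar> + 1"
  have "isCont k s" for s
    unfolding k_def by (rule isCont_form1_along_integral_curve[OF assms])
  then have "continuous_on {-R..R} k"
    by (simp add: continuous_at_imp_continuous_on)
  then have "((\<lambda>u. LBINT y=0..u. k y) has_vector_derivative k t) (at t within {-R..R})"
    using interval_integral_FTC2[of "-R" 0 R k t] unfolding R_def zero_ereal_def by auto
  moreover have "t \<in> interior {-R..R}"
    unfolding R_def by (auto simp: abs_if)
  ultimately show ?thesis
    unfolding winding_def k_def zero_ereal_def has_real_derivative_iff_has_vector_derivative
    by (metis at_within_interior)
qed

end

section \<open>Growth of the Hamiltonian and excursions of an orbit\<close>

text \<open>The argument by first and last times.  The hypotheses \<open>exp\<close> and \<open>B\<close> bound the change of \<open>r\<close> between any two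
  times at which \<open>\<epsilon> \<le> \<bar>h\<bar>\<close>, whatever \<open>h\<close> does in between; \<open>small\<close> bounds it on the two remaining pieces.\<close>

lemma bound_by_excursions:
  fixes r h :: "real \<Rightarrow> real"
  assumes h: "continuous_on UNIV h" and exp: "\<And>s t. h t = h s * exp (r t - r s)"
    and \<epsilon>: "0 < \<epsilon>" "\<epsilon> \<le> B" and B: "\<And>t. \<bar>h t\<bar> \<le> B" and C: "0 \<le> C"
    and small: "\<And>s t. s \<le> t \<Longrightarrow> (\<And>u. u \<in> {s..t} \<Longrightarrow> \<bar>h u\<bar> \<le> \<epsilon>) \<Longrightarrow> \<bar>r t - r s\<bar> \<le> C"
    and "s \<le> t"
  shows "\<bar>r t - r s\<bar> \<le> 2 * C + ln (B / \<epsilon>)"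
proof -
  have cont: "continuous_on S (\<lambda>u. \<bar>h u\<bar>)" for S
    by (intro continuous_intros continuous_on_subset[OF h]) auto
  have large: "r v - r u \<le> ln (B / \<epsilon>)" if "\<epsilon> \<le> \<bar>h u\<bar>" for u v
  proof -
    have "\<epsilon> * exp (r v - r u) \<le> \<bar>h u\<bar> * exp (r v - r u)"
      using that by (simp add: mult_right_mono)
    also have "\<dots> = \<bar>h v\<bar>"
      using exp[of v u] by (simp add: abs_mult)
    also have "\<dots> \<le> B" by (rule B)
    finally have "exp (r v - r u) \<le> B / \<epsilon>"
      using \<epsilon> by (simp add: field_simps)
    then show ?thesis
      using \<epsilon> by (simp add: ln_ge_iff)
  qed
  define S where "S = {u \<in> {s..t}. \<epsilon> \<le> \<bar>h u\<bar>}"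
  show ?thesis
  proof (cases "S = {}")
    case True
    then have "\<bar>r t - r s\<bar> \<le> C"
      using \<open>s \<le> t\<close> unfolding S_def by (intro small) force+
    moreover have "0 \<le> ln (B / \<epsilon>)" using \<epsilon> by simp
    ultimately show ?thesis using C by linarith
  next
    case False
    have "closed S"
    proof -
      have "closed {u. \<epsilon> \<le> \<bar>h u\<bar>}"
        by (rule closed_Collect_le[OF continuous_on_const cont])
      moreover have "S = {s..t} \<inter> {u. \<epsilon> \<le> \<bar>h u\<bar>}"
        unfolding S_def by blast
      ultimately show ?thesis by (simp add: closed_Int)
    qed
    then have "compact S"
      unfolding S_def compact_eq_bounded_closed by (auto intro: bounded_subset[of "{s..t}"])
    then obtain a b where a: "a \<in> S" "\<And>u. u \<in> S \<Longrightarrow> a \<le> u" and b: "b \<in> S" "\<And>u. u \<in> S \<Longrightarrow> u \<le> b"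
      using False compact_attains_inf compact_attains_sup by metis
    \<comment> \<open>At \<open>a\<close> itself \<open>small\<close> needs \<open>\<bar>h a\<bar> \<le> \<epsilon>\<close>: unless \<open>a = s\<close>, the value \<open>\<epsilon>\<close> is taken in
      \<open>{s..a}\<close>, hence at \<open>a\<close>, because \<open>a\<close> is the first element of \<open>S\<close>.  The time \<open>b\<close> is treated
      in the same way.\<close>
    have "\<bar>r a - r s\<bar> \<le> C"
    proof (cases "\<epsilon> \<le> \<bar>h s\<bar>")
      case True
      then have "a = s"
        using a(1) a(2)[of s] \<open>s \<le> t\<close> unfolding S_def by auto
      then show ?thesis using C by simp
    next
      case False
      obtain v where "s \<le> v" "v \<le> a" "\<bar>h v\<bar> = \<epsilon>"
        using IVT'[of "\<lambda>u. \<bar>h u\<bar>" s \<epsilon> a] cont a(1) False unfolding S_def by auto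
      moreover from this have "v \<in> S"
        using a(1) unfolding S_def by auto
      ultimately have "\<bar>h a\<bar> = \<epsilon>"
        using a(2) by force
      show ?thesis
      proof (rule small)
        show "s \<le> a" using a(1) unfolding S_def by simp
        show "\<bar>h u\<bar> \<le> \<epsilon>" if "u \<in> {s..a}" for u
          using that a(1) a(2)[of u] \<open>\<bar>h a\<bar> = \<epsilon>\<close> unfolding S_def by (cases "u = a"; cases "\<epsilon> \<le> \<bar>h u\<bar>") auto
      qed
    qed
    moreover have "\<bar>r t - r b\<bar> \<le> C"
    proof (cases "\<epsilon> \<le> \<bar>h t\<bar>")
      case True
      then have "b = t"
        using b(1) b(2)[of t] \<open>s \<le> t\<close> unfolding S_def by auto
      then show ?thesis using C by simp
    next
      case False
      obtain v where "b \<le> v" "v \<le> t" "\<bar>h v\<bar> = \<epsilon>"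
        using IVT2'[of "\<lambda>u. \<bar>h u\<bar>" t \<epsilon> b] cont b(1) False unfolding S_def by auto
      moreover from this have "v \<in> S"
        using b(1) unfolding S_def by auto
      ultimately have "\<bar>h b\<bar> = \<epsilon>"
        using b(2) by force
      show ?thesis
      proof (rule small)
        show "b \<le> t" using b(1) unfolding S_def by simp
        show "\<bar>h u\<bar> \<le> \<epsilon>" if "u \<in> {b..t}" for u
          using that b(1) b(2)[of u] \<open>\<bar>h b\<bar> = \<epsilon>\<close> unfolding S_def by (cases "u = b"; cases "\<epsilon> \<le> \<bar>h u\<bar>") auto
      qed
    qed
    moreover have "\<bar>r b - r a\<bar> \<le> ln (B / \<epsilon>)"
      using large[of a b] large[of b a] a(1) b(1) unfolding S_def by auto
    ultimately show ?thesis by linarith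
  qed
qed

text \<open>Contracting \<open>\<iota>\<^sub>X \<omega> = dH - H \<eta>\<close> with \<open>X\<close> gives \<open>dH(X) = H \<eta>(X)\<close>, so \<open>H\<close> solves a linear
  equation along orbits.  Solving it by the integrating factor \<open>exp (- r)\<close> covers the orbits in
  \<open>{H = 0}\<close> as well, where the logarithm of \<open>H\<close> is not available.\<close>

lemma hamiltonian_along_flow:
  assumes "conformal_symplectic_manifold M A \<eta> \<omega>"
    and H: "smooth_fun_on A (topspace M) H"
    and X: "hamiltonian_vector_field M A \<eta> \<omega> H X"
    and \<gamma>: "integral_curve M A X (\<lambda>t. \<phi> t x)"
  shows "H (\<phi> t x) = H (\<phi> s x) * exp (winding \<eta> X \<phi> t x - winding \<eta> X \<phi> s x)"
proof -
  interpret conformal_symplectic_manifold M A \<eta> \<omega> by fact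
  define k where "k = (\<lambda>t. \<eta> (\<phi> t x) (X (\<phi> t x)))"
  define r where "r = (\<lambda>t. winding \<eta> X \<phi> t x)"
  define h where "h = (\<lambda>t. H (\<phi> t x))"
  have Xs: "smooth_vector_field M A X"
    using X unfolding hamiltonian_vector_field_def by blast
  have r: "(r has_real_derivative k t) (at t)" for t
    unfolding r_def k_def by (rule winding_has_real_derivative[where \<phi> = \<phi> and x = x, OF lee_form_smooth Xs \<gamma>])
  have top: "\<phi> t x \<in> topspace M" for t
    using \<gamma> unfolding integral_curve_def continuous_map_def by auto
  have h: "(h has_real_derivative h t * k t) (at t)" for t
  proof -
    let ?p = "\<phi> t x"
    have "X ?p \<in> tangent_space A ?p"
      using Xs top unfolding smooth_vector_field_def by blast
    then have "lee_deriv0 A \<eta> H ?p (X ?p) = 0"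
      using X form_smooth top unfolding hamiltonian_vector_field_def smooth_form2_def by metis
    then have "deriv_along A H ?p (X ?p) = h t * k t"
      unfolding lee_deriv0_def h_def k_def by simp
    then show ?thesis
      using has_derivative_along_integral_curve[OF H openin_topspace \<gamma> top, of t]
      unfolding h_def by simp
  qed
  have "((\<lambda>t. h t * exp (- r t)) has_real_derivative 0) (at t)" for t
    by (rule derivative_eq_intros h r refl | simp)+
  then have "h t * exp (- r t) = h s * exp (- r s)"
    using DERIV_isconst_all by blast
  then have "h t = h s * exp (r t - r s)"
    by (simp add: exp_diff exp_minus field_simps)
  then show ?thesis
    unfolding h_def r_def .
qed

theorem proposition14:
  fixes M :: "'m topology" and A :: "('m, 'e::euclidean_space) chart set"
    and \<eta> :: "('m, 'e) form1" and \<omega> :: "('m, 'e) form2"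
    and H :: "'m \<Rightarrow> real" and X :: "('m, 'e) vector_field" and \<phi> :: "real \<Rightarrow> 'm \<Rightarrow> 'm"
    and U :: "'m set"
  assumes "conformal_symplectic_manifold M A \<eta> \<omega>"
    and "compact_space M"
    and "smooth_fun_on A (topspace M) H"
    and "hamiltonian_vector_field M A \<eta> \<omega> H X"
    and "is_flow M A X \<phi>"
    and "openin M U"
    and "{p \<in> topspace M. H p = 0} \<subseteq> U"
    and "exact_on A U \<eta>"
  shows "bounded ((\<lambda>(t, x). winding \<eta> X \<phi> t x) ` (UNIV \<times> topspace M))"
proof -
  interpret conformal_symplectic_manifold M A \<eta> \<omega> by fact
  have Xs: "smooth_vector_field M A X"
    using assms(4) unfolding hamiltonian_vector_field_def by blast
  have Hc: "continuous_map M euclideanreal H"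
    using smooth_fun_on_continuous_map[OF assms(3)] by simp
  then have absH: "continuous_map M euclideanreal (\<lambda>p. \<bar>H p\<bar>)"
    using continuous_map_real_abs by blast
  obtain f where f: "smooth_fun_on A U f"
    and df: "\<And>p u. p \<in> U \<Longrightarrow> u \<in> tangent_space A p \<Longrightarrow> \<eta> p u = deriv_along A f p u"
    using assms(8) unfolding exact_on_def by blast
  \<comment> \<open>On the compact set \<open>topspace M - U\<close> the function \<open>\<bar>H\<bar>\<close> is bounded below by some \<open>d > 0\<close>; half of
    \<open>d\<close> serves as \<open>\<epsilon>\<close>, since the inequality that defines the sublevel set is not strict.\<close>
  obtain \<epsilon> where \<epsilon>: "0 < \<epsilon>" and sub: "{p \<in> topspace M. \<bar>H p\<bar> \<le> \<epsilon>} \<subseteq> U"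
  proof -
    have "compactin M (topspace M - U)"
      using closedin_compact_space[OF assms(2)] assms(6) by blast
    then have cpt: "compact ((\<lambda>p. \<bar>H p\<bar>) ` (topspace M - U))"
      using image_compactin[OF _ absH] by simp
    have "0 \<notin> (\<lambda>p. \<bar>H p\<bar>) ` (topspace M - U)"
      using assms(7) by auto
    then obtain d where d: "0 < d" "\<And>y. y \<in> (\<lambda>p. \<bar>H p\<bar>) ` (topspace M - U) \<Longrightarrow> d \<le> dist 0 y"
      using separate_point_closed compact_imp_closed[OF cpt] by metis
    have "{p \<in> topspace M. \<bar>H p\<bar> \<le> d / 2} \<subseteq> U"
      using d by force
    then show ?thesis using d(1) that[of "d / 2"] by simp
  qed
  obtain B where B: "\<epsilon> \<le> B" "\<And>p. p \<in> topspace M \<Longrightarrow> \<bar>H p\<bar> \<le> B"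
  proof -
    have "compact (H ` topspace M)"
      using image_compactin[OF _ Hc] assms(2) unfolding compact_space_def by simp
    then obtain B where "\<forall>y\<in>H ` topspace M. norm y \<le> B"
      using compact_imp_bounded bounded_iff by blast
    then show ?thesis using that[of "max B \<epsilon>"] by fastforce
  qed
  obtain C where C: "0 \<le> C" "\<And>p. p \<in> topspace M \<Longrightarrow> \<bar>H p\<bar> \<le> \<epsilon> \<Longrightarrow> \<bar>f p\<bar> \<le> C"
  proof -
    have "closedin M {p \<in> topspace M. \<bar>H p\<bar> \<in> {..\<epsilon>}}"
      by (rule closedin_continuous_map_preimage[OF absH]) simp
    then have "compactin M {p \<in> topspace M. \<bar>H p\<bar> \<le> \<epsilon>}"
      using closedin_compact_space[OF assms(2)] by simp
    then have "compactin (subtopology M U) {p \<in> topspace M. \<bar>H p\<bar> \<le> \<epsilon>}"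
      using sub by (simp add: compactin_subtopology)
    then have "compact (f ` {p \<in> topspace M. \<bar>H p\<bar> \<le> \<epsilon>})"
      using image_compactin[OF _ smooth_fun_on_continuous_map[OF f assms(6)]] by simp
    then obtain C where "\<forall>y\<in>f ` {p \<in> topspace M. \<bar>H p\<bar> \<le> \<epsilon>}. norm y \<le> C"
      using compact_imp_bounded bounded_iff by blast
    then show ?thesis using that[of "max C 0"] by fastforce
  qed
  have "\<bar>winding \<eta> X \<phi> t x\<bar> \<le> 2 * (2 * C) + ln (B / \<epsilon>)" if x: "x \<in> topspace M" for t x
  proof -
    have \<gamma>: "integral_curve M A X (\<lambda>t. \<phi> t x)"
      using assms(5) x unfolding is_flow_def by blast
    define r where "r = (\<lambda>t. winding \<eta> X \<phi> t x)"
    define h where "h = (\<lambda>t. H (\<phi> t x))"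
    have top: "\<phi> t x \<in> topspace M" for t
      using \<gamma> unfolding integral_curve_def continuous_map_def by auto
    have hc: "continuous_on UNIV h"
      using continuous_map_compose[OF _ Hc] \<gamma> unfolding integral_curve_def h_def
      by (force simp: o_def)
    have exp: "h t = h s * exp (r t - r s)" for s t
      unfolding h_def r_def by (rule hamiltonian_along_flow[where \<phi> = \<phi> and x = x, OF assms(1,3,4) \<gamma>])
    \<comment> \<open>Two values of \<open>f\<close> on the sublevel set differ by at most \<open>2 * C\<close>.\<close>
    have small: "\<bar>r t - r s\<bar> \<le> 2 * C"
      if "s \<le> t" and le: "\<And>u. u \<in> {s..t} \<Longrightarrow> \<bar>h u\<bar> \<le> \<epsilon>" for s t
    proof -
      have inU: "\<phi> u x \<in> U" if "u \<in> {s..t}" for u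
        using sub top le[OF that] unfolding h_def by blast
      have D: "((\<lambda>u. r u - f (\<phi> u x)) has_real_derivative 0) (at u)" if "u \<in> {s..t}" for u
      proof -
        have "X (\<phi> u x) \<in> tangent_space A (\<phi> u x)"
          using Xs top unfolding smooth_vector_field_def by blast
        then show ?thesis
          using DERIV_diff[OF winding_has_real_derivative[where \<phi> = \<phi> and x = x, OF lee_form_smooth Xs \<gamma>, of u]
              has_derivative_along_integral_curve[OF f assms(6) \<gamma> inU[OF that]]]
            df[OF inU[OF that]] unfolding r_def by simp
      qed
      have "r t - f (\<phi> t x) = r s - f (\<phi> s x)"
      proof (cases "s = t")
        case False
        with \<open>s \<le> t\<close> have "s < t" by simp
        then show ?thesis
          using DERIV_isconst_end[of s t "\<lambda>u. r u - f (\<phi> u x)"] D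
          by (meson DERIV_continuous_on atLeastAtMost_iff has_field_derivative_at_within less_imp_le)
      qed simp
      moreover have "\<bar>f (\<phi> s x)\<bar> \<le> C" "\<bar>f (\<phi> t x)\<bar> \<le> C"
        using C(2)[OF top] le \<open>s \<le> t\<close> unfolding h_def by auto
      ultimately show ?thesis by linarith
    qed
    have bound: "\<bar>r t - r s\<bar> \<le> 2 * (2 * C) + ln (B / \<epsilon>)" if "s \<le> t" for s t
      by (rule bound_by_excursions[OF hc exp \<epsilon> B(1) _ _ small that])
        (use B(2)[OF top] C(1) in \<open>auto simp: h_def\<close>)
    have "r 0 = 0"
      unfolding r_def winding_def by (simp add: zero_ereal_def[symmetric])
    then show ?thesis
      using bound[of 0 t] bound[of t 0] unfolding r_def by (cases "0 \<le> t") auto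
  qed
  then show ?thesis
    unfolding bounded_iff by auto
qed

end
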